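(* Let $\mathbb{K}$ be a field, $\mathcal{I}$ a set, $\mathcal{S}\subset\mathcal{I}\times\mathcal{I}$, and let $\langle\mathbb{K}[\mathcal{I}];R\rangle\cong\langle\mathcal{I};\mathcal{S},f\rangle$ be a dualizable $(\mathcal{I},\mathcal{S})$-admissible quadratic coalgebra which is strictly self-dual with respect to the bijection $\sigma:\mathcal{I}\to\mathcal{I}$. The following conditions on a subset $\mathcal{J}\subset\mathcal{I}$ are equivalent: (1) the pullback quadratic coalgebra $\langle\mathbb{K}[\mathcal{J}];R_{\mathbb{K}[\mathcal{J}]}\rangle$ is $(\mathcal{J},\mathcal{S}_{\mathcal{J}})$-admissible; (2) the pushforward quadratic coalgebra $\langle\mathbb{K}[\sigma(\mathcal{J})];R^{\mathbb{K}[\sigma(\mathcal{J})]}\rangle$ is $(\sigma(\mathcal{J}),\mathcal{S}_{\sigma(\mathcal{J})})$-admissible.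
   Context: For a $\mathbb{K}$-vector space $V$ and $R\le V^{\otimes2}$, $\langle V;R\rangle$ is the quadratic coalgebra given by $\mathbb{K}$ in degree $0$, $V$ in degree $1$, $\bigcap_{i+j+2=n}V^{\otimes i}\otimes R\otimes V^{\otimes j}$ in degree $n\ge2$ (a subcoalgebra of the tensor coalgebra on $V$). For a set $\mathcal{I}$, $\mathbb{K}[\mathcal{I}]$ is the free vector space with basis $\{[i]\}_{i\in\mathcal I}$, and $\mathbb{K}[\mathcal{I}]\otimes\mathbb{K}[\mathcal{I}]=\mathbb{K}[\mathcal{I}\times\mathcal{I}]$. For $\mathcal{X}\subset\mathcal{Y}$, the canonical inclusion is $\mathbb{K}[\mathcal{X}]\hookrightarrow\mathbb{K}[\mathcal{Y}]$ and the canonical projection $\mathbb{K}[\mathcal{Y}]\twoheadrightarrow\mathbb{K}[\mathcal{X}]$ sends $[w]$ to $[w]$ if $w\in\mathcal{X}$ and to $0$ otherwise. $\langle\mathbb{K}[\mathcal{I}];R\rangle$ is $(\mathcal{I},\mathcal{S})$-admissible (with respect to the canonical basis) if the composite $R\hookrightarrow\mathbb{K}[\mathcal{I}\times\mathcal{I}]\twoheadrightarrow\mathbb{K}[\mathcal{S}]$ is an isomorphism. Writing $\mathcal{S}'$ for the complement of $\mathcal{S}$ in $\mathcal{I}\times\mathcal{I}$, $R$ then has the basis $[s]-\sum_{s'\in\mathcal{S}'}f(s,s')[s']$ ($s\in\mathcal{S}$) for a unique $f:\mathcal{S}\times\mathcal{S}'\to\mathbb{K}$ with each $f(s,-)$ of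 finite support, and the coalgebra is denoted $\langle\mathcal{I};\mathcal{S},f\rangle$. It is dualizable if each $f(-,s')$ has finite support. With $f^!(s',s):=f(s,s')$, it is strictly self-dual with respect to a bijection $\sigma:\mathcal{I}\to\mathcal{I}$ if (componentwise) $\sigma$ restricts to a bijection $\mathcal{S}\to\mathcal{S}'$ and $f(s,s')=f^!(\sigma(s),\sigma(s'))$ for all $s\in\mathcal S$, $s'\in\mathcal S'$. For $\mathcal{J}\subset\mathcal{I}$: $\mathcal{S}_{\mathcal{J}}:=\mathcal{S}\cap(\mathcal{J}\times\mathcal{J})$; $R_{\mathbb{K}[\mathcal{J}]}:=R\cap\mathbb{K}[\mathcal{J}]^{\otimes2}$ defines the pullback quadratic coalgebra; $R^{\mathbb{K}[\mathcal{J}]}:=$ the image of $R$ under the canonical projection $\mathbb{K}[\mathcal{I}]^{\otimes2}\twoheadrightarrow\mathbb{K}[\mathcal{J}]^{\otimes2}$ defines the pushforward quadratic coalgebra. Admissibility of these is meant with respect to the canonical bases of $\mathbb{K}[\mathcal{J}]$, $\mathbb{K}[\sigma(\mathcal{J})]$. *)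

theory Defs
  imports Complex_Main "HOL-Library.Poly_Mapping"
begin

section \<open>Free vector spaces\<close>

text \<open>
  The free vector space \<open>\<bbbK>[X]\<close> on a set \<open>X :: 'a set\<close> is the set of finitely supported
  functions \<^typ>\<open>'a \<Rightarrow>\<^sub>0 'k\<close> whose support is contained in \<open>X\<close>; the basis vector \<open>[x]\<close> is
  \<open>Poly_Mapping.single x 1\<close>. With this encoding the canonical inclusions
  \<open>\<bbbK>[X] \<hookrightarrow> \<bbbK>[Y]\<close>, for \<open>X \<subseteq> Y\<close>, are literal inclusions of sets.
\<close>

definition scale :: "'k::field \<Rightarrow> ('a \<Rightarrow>\<^sub>0 'k) \<Rightarrow> ('a \<Rightarrow>\<^sub>0 'k)"
  where "scale c x = Poly_Mapping.map (\<lambda>a. c * a) x"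

lemma lookup_scale: "Poly_Mapping.lookup (scale c x) w = c * Poly_Mapping.lookup x w"
  by (simp add: scale_def map.rep_eq when_def)

global_interpretation free: vector_space scale
  by unfold_locales (auto intro!: poly_mapping_eqI simp: lookup_scale lookup_add algebra_simps)

definition free_on :: "'a set \<Rightarrow> ('a \<Rightarrow>\<^sub>0 'k::field) set"
  where "free_on X = {x. Poly_Mapping.keys x \<subseteq> X}"

definition proj :: "'a set \<Rightarrow> ('a \<Rightarrow>\<^sub>0 'k::field) \<Rightarrow> ('a \<Rightarrow>\<^sub>0 'k)"
  where "proj X x = (\<Sum>w\<in>Poly_Mapping.keys x \<inter> X.
    Poly_Mapping.single w (Poly_Mapping.lookup x w))"

section \<open>Quadratic coalgebras\<close>

text \<open>
  The tensor coalgebra on \<open>\<bbbK>[I]\<close> has the words over \<open>I\<close> as a basis, the words of length \<open>n\<close>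
  spanning \<open>\<bbbK>[I]\<^sup>\<otimes>\<^sup>n\<close>. Its comultiplication is deconcatenation; the tensor square of the
  tensor coalgebra has the pairs of words as a basis.
\<close>

definition tensor_power :: "'i set \<Rightarrow> nat \<Rightarrow> ('i list \<Rightarrow>\<^sub>0 'k::field) set"
  where "tensor_power I n = free_on {w \<in> lists I. length w = n}"

definition deconcat :: "('i list \<Rightarrow>\<^sub>0 'k::field) \<Rightarrow> ('i list \<times> 'i list \<Rightarrow>\<^sub>0 'k)"
  where "deconcat x =
    (\<Sum>w\<in>Poly_Mapping.keys x. \<Sum>k\<le>length w.
      Poly_Mapping.single (take k w, drop k w) (Poly_Mapping.lookup x w))"

definition word_counit :: "('i list \<Rightarrow>\<^sub>0 'k::field) \<Rightarrow> 'k"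
  where "word_counit x = Poly_Mapping.lookup x []"

text \<open>The tensor \<open>[u] \<otimes> r \<otimes> [v]\<close> for words \<open>u\<close>, \<open>v\<close> and \<open>r \<in> \<bbbK>[I \<times> I] = \<bbbK>[I]\<^sup>\<otimes>\<^sup>2\<close>:\<close>

definition insert_tensor ::
    "'i list \<Rightarrow> ('i \<times> 'i \<Rightarrow>\<^sub>0 'k::field) \<Rightarrow> 'i list \<Rightarrow> ('i list \<Rightarrow>\<^sub>0 'k)"
  where "insert_tensor u r v =
    (\<Sum>(a, b)\<in>Poly_Mapping.keys r.
      Poly_Mapping.single (u @ [a, b] @ v) (Poly_Mapping.lookup r (a, b)))"

text \<open>The subspace \<open>V\<^sup>\<otimes>\<^sup>i \<otimes> R \<otimes> V\<^sup>\<otimes>\<^sup>j\<close> of \<open>V\<^bsup>\<otimes>(i+j+2)\<^esup>\<close>, where \<open>V = \<bbbK>[I]\<close>:\<close>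

definition sandwich ::
    "'i set \<Rightarrow> ('i \<times> 'i \<Rightarrow>\<^sub>0 'k::field) set \<Rightarrow> nat \<Rightarrow> nat \<Rightarrow> ('i list \<Rightarrow>\<^sub>0 'k) set"
  where "sandwich I R i j =
    free.span {insert_tensor u r v | u r v.
      u \<in> lists I \<and> length u = i \<and> r \<in> R \<and> v \<in> lists I \<and> length v = j}"

text \<open>
  Graded subcoalgebras of a tensor coalgebra: the comultiplication and the counit are those of
  the tensor coalgebra and are to be read as restricted to the components.
\<close>

record (overloaded) ('i, 'k::zero) word_coalgebra =
  component :: "nat \<Rightarrow> ('i list \<Rightarrow>\<^sub>0 'k) set"
  comult :: "('i list \<Rightarrow>\<^sub>0 'k) \<Rightarrow> ('i list \<times> 'i list \<Rightarrow>\<^sub>0 'k)"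
  counit :: "('i list \<Rightarrow>\<^sub>0 'k) \<Rightarrow> 'k"

text \<open>
  The coalgebra \<open>\<langle>\<bbbK>[I]; R\<rangle>\<close>. For \<open>n < 2\<close> there are no \<open>i\<close>, \<open>j\<close> with \<open>i + j + 2 = n\<close>, so that the
  components in degrees \<open>0\<close> and \<open>1\<close> are \<open>\<bbbK>\<close> and \<open>\<bbbK>[I]\<close>.
\<close>

definition quadratic_coalgebra ::
    "'i set \<Rightarrow> ('i \<times> 'i \<Rightarrow>\<^sub>0 'k::field) set \<Rightarrow> ('i, 'k) word_coalgebra"
  where "quadratic_coalgebra I R =
    \<lparr> component = (\<lambda>n. {x \<in> tensor_power I n. \<forall>i j. i + j + 2 = n \<longrightarrow> x \<in> sandwich I R i j}),
      comult = deconcat,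
      counit = word_counit \<rparr>"

section \<open>Admissibility, dualizability and self-duality\<close>

text \<open>
  The projection is linear, so the composite \<open>R \<hookrightarrow> \<bbbK>[I \<times> I] \<rightarrow> \<bbbK>[S]\<close> is an isomorphism if and only
  if it is bijective. The space \<open>R\<close> is determined by the coalgebra, being its component in
  degree \<open>2\<close>.
\<close>

definition admissible ::
    "'i set \<Rightarrow> ('i \<times> 'i) set \<Rightarrow> ('i, 'k::field) word_coalgebra \<Rightarrow> bool"
  where "admissible I S C \<longleftrightarrow>
    S \<subseteq> I \<times> I \<and>
    (\<exists>R. free.subspace R \<and> R \<subseteq> free_on (I \<times> I) \<and> C = quadratic_coalgebra I R \<and>
         bij_betw (proj S) R (free_on S))"

definition compl_pairs :: "'i set \<Rightarrow> ('i \<times> 'i) set \<Rightarrow> ('i \<times> 'i) set"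
  where "compl_pairs I S = I \<times> I - S"

definition relation_vector ::
    "'i set \<Rightarrow> ('i \<times> 'i) set \<Rightarrow> ('i \<times> 'i \<Rightarrow> 'i \<times> 'i \<Rightarrow> 'k::field) \<Rightarrow> 'i \<times> 'i \<Rightarrow>
     ('i \<times> 'i \<Rightarrow>\<^sub>0 'k)"
  where "relation_vector I S f s =
    Poly_Mapping.single s 1 -
    (\<Sum>s'\<in>{s' \<in> compl_pairs I S. f s s' \<noteq> 0}. Poly_Mapping.single s' (f s s'))"

text \<open>
  \<open>\<langle>\<bbbK>[I]; R\<rangle>\<close> is \<open>\<langle>I; S, f\<rangle>\<close>. Only the values \<open>f s s'\<close> with \<open>s \<in> S\<close> and
  \<open>s' \<in> compl_pairs I S\<close> are relevant, here and below.
\<close>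

definition has_coefficients ::
    "'i set \<Rightarrow> ('i \<times> 'i) set \<Rightarrow> ('i \<times> 'i \<Rightarrow> 'i \<times> 'i \<Rightarrow> 'k::field) \<Rightarrow>
     ('i \<times> 'i \<Rightarrow>\<^sub>0 'k) set \<Rightarrow> bool"
  where "has_coefficients I S f R \<longleftrightarrow>
    (\<forall>s\<in>S. finite {s' \<in> compl_pairs I S. f s s' \<noteq> 0}) \<and>
    inj_on (relation_vector I S f) S \<and>
    free.independent (relation_vector I S f ` S) \<and>
    free.span (relation_vector I S f ` S) = R"

definition dualizable ::
    "'i set \<Rightarrow> ('i \<times> 'i) set \<Rightarrow> ('i \<times> 'i \<Rightarrow> 'i \<times> 'i \<Rightarrow> 'k::field) \<Rightarrow> bool"
  where "dualizable I S f \<longleftrightarrow> (\<forall>s'\<in>compl_pairs I S. finite {s \<in> S. f s s' \<noteq> 0})"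

definition dual_coeff ::
    "('i \<times> 'i \<Rightarrow> 'i \<times> 'i \<Rightarrow> 'k) \<Rightarrow> 'i \<times> 'i \<Rightarrow> 'i \<times> 'i \<Rightarrow> 'k"
  where "dual_coeff f s' s = f s s'"

definition strictly_self_dual ::
    "'i set \<Rightarrow> ('i \<times> 'i) set \<Rightarrow> ('i \<times> 'i \<Rightarrow> 'i \<times> 'i \<Rightarrow> 'k::field) \<Rightarrow> ('i \<Rightarrow> 'i) \<Rightarrow> bool"
  where "strictly_self_dual I S f \<sigma> \<longleftrightarrow>
    bij_betw \<sigma> I I \<and>
    bij_betw (map_prod \<sigma> \<sigma>) S (compl_pairs I S) \<and>
    (\<forall>s\<in>S. \<forall>s'\<in>compl_pairs I S.
       f s s' = dual_coeff f (map_prod \<sigma> \<sigma> s) (map_prod \<sigma> \<sigma> s'))"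

section \<open>Pullback and pushforward\<close>

definition pullback_rel ::
    "'i set \<Rightarrow> ('i \<times> 'i \<Rightarrow>\<^sub>0 'k::field) set \<Rightarrow> ('i \<times> 'i \<Rightarrow>\<^sub>0 'k) set"
  where "pullback_rel J R = R \<inter> free_on (J \<times> J)"

definition pushforward_rel ::
    "'i set \<Rightarrow> ('i \<times> 'i \<Rightarrow>\<^sub>0 'k::field) set \<Rightarrow> ('i \<times> 'i \<Rightarrow>\<^sub>0 'k) set"
  where "pushforward_rel J R = proj (J \<times> J) ` R"

definition restrict_pairs :: "('i \<times> 'i) set \<Rightarrow> 'i set \<Rightarrow> ('i \<times> 'i) set"
  where "restrict_pairs S J = S \<inter> (J \<times> J)"

end

theory Submission
  imports Defs
begin

text \<open>
  Write \<open>r s = [s] - \<Sum>s'. f s s' [s']\<close> for the basis vectors of \<open>R\<close>, and \<open>K = \<sigma>(J)\<close>. Since an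
  element of \<open>R\<close> is determined by its coordinates in \<open>S\<close>, the pullback to \<open>J\<close> is admissible
  if and only if \<open>r s\<close> lies in \<open>\<bbbK>[J \<times> J]\<close> for all \<open>s \<in> S \<inter> (J \<times> J)\<close>, that is, if \<open>f\<close> vanishes on
  \<open>(S \<inter> J\<^sup>2) \<times> (S' - J\<^sup>2)\<close>. Dually, the pushforward to \<open>K\<close> is admissible if and only if \<open>r s\<close> is killed
  by the projection to \<open>\<bbbK>[K \<times> K]\<close> for all \<open>s \<in> S - K\<^sup>2\<close>, that is, if \<open>f\<close> vanishes on
  \<open>(S - K\<^sup>2) \<times> (S' \<inter> K\<^sup>2)\<close>. Self-duality \<open>f s s' = f (\<sigma> s') (\<sigma> s)\<close> interchanges the two vanishing
  conditions.
\<close>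

section \<open>Coordinates of projections; pullback and pushforward as subspaces\<close>

lemma lookup_proj:
  "Poly_Mapping.lookup (proj X x) w = (if w \<in> X then Poly_Mapping.lookup x w else 0)"
  by (auto simp: proj_def lookup_sum lookup_single when_def sum.delta' in_keys_iff)

lemma proj_diff: "proj X (x - y) = proj X x - proj X y"
  by (rule poly_mapping_eqI) (simp add: lookup_proj lookup_minus)

lemma proj_0 [simp]: "proj X 0 = 0"
  by (rule poly_mapping_eqI) (simp add: lookup_proj)

lemma in_free_on_iff: "x \<in> free_on X \<longleftrightarrow> (\<forall>w. w \<notin> X \<longrightarrow> Poly_Mapping.lookup x w = 0)"
  by (auto simp: free_on_def in_keys_iff)

lemma proj_in_free_on: "proj X x \<in> free_on X"
  by (simp add: in_free_on_iff lookup_proj)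

lemma subspace_free_on: "free.subspace (free_on X)"
  by (auto simp: free.subspace_def in_free_on_iff lookup_add lookup_scale)

lemma subspace_pullback_rel: "free.subspace R \<Longrightarrow> free.subspace (pullback_rel J R)"
  unfolding pullback_rel_def by (intro free.subspace_inter subspace_free_on)

lemma pullback_rel_subset: "pullback_rel J R \<subseteq> free_on (J \<times> J)"
  by (simp add: pullback_rel_def)

lemma subspace_pushforward_rel:
  assumes "free.subspace R"
  shows "free.subspace (pushforward_rel J R)"
proof -
  have "0 \<in> pushforward_rel J R"
    unfolding pushforward_rel_def
    using free.subspace_0[OF assms] by (intro image_eqI[of _ _ 0]) auto
  moreover have "x + y \<in> pushforward_rel J R"
    if xy: "x \<in> pushforward_rel J R" "y \<in> pushforward_rel J R" for x y
  proof -
    obtain x' y' where "x = proj (J \<times> J) x'" "y = proj (J \<times> J) y'" "x' \<in> R" "y' \<in> R"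
      using xy unfolding pushforward_rel_def by blast
    then show ?thesis
      unfolding pushforward_rel_def using free.subspace_add[OF assms]
      by (intro image_eqI[of _ _ "x' + y'"])
        (auto intro!: poly_mapping_eqI simp: lookup_proj lookup_add)
  qed
  moreover have "scale c x \<in> pushforward_rel J R" if x: "x \<in> pushforward_rel J R" for c x
  proof -
    obtain x' where "x = proj (J \<times> J) x'" "x' \<in> R"
      using x unfolding pushforward_rel_def by blast
    then show ?thesis
      unfolding pushforward_rel_def using free.subspace_scale[OF assms]
      by (intro image_eqI[of _ _ "scale c x'"])
        (auto intro!: poly_mapping_eqI simp: lookup_proj lookup_scale)
  qed
  ultimately show ?thesis
    by (simp add: free.subspace_def)
qed

lemma pushforward_rel_subset: "pushforward_rel J R \<subseteq> free_on (J \<times> J)"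
  by (auto simp: pushforward_rel_def proj_in_free_on)

section \<open>Recovering the relation space from the degree 2 component\<close>

lemma lookup_insert_tensor_Nil:
  "Poly_Mapping.lookup (insert_tensor [] r []) w =
    (case w of [a, b] \<Rightarrow> Poly_Mapping.lookup r (a, b) | _ \<Rightarrow> 0)"
proof (cases "\<exists>a b. w = [a, b]")
  case True
  then obtain a b where w: "w = [a, b]"
    by blast
  have "Poly_Mapping.lookup (insert_tensor [] r []) w =
      (\<Sum>p\<in>Poly_Mapping.keys r. if p = (a, b) then Poly_Mapping.lookup r p else 0)"
    unfolding insert_tensor_def lookup_sum
    by (rule sum.cong) (auto simp: w lookup_single when_def split: prod.splits)
  then show ?thesis
    by (simp add: w in_keys_iff)
next
  case False
  then have "Poly_Mapping.lookup (insert_tensor [] r []) w = 0"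
    unfolding insert_tensor_def lookup_sum
    by (intro sum.neutral) (auto simp: lookup_single when_def)
  with False show ?thesis
    by (auto split: list.split)
qed

lemma inj_insert_tensor_Nil: "inj (\<lambda>r. insert_tensor [] r [])"
proof (rule injI, rule poly_mapping_eqI)
  fix r r' :: "'a \<times> 'a \<Rightarrow>\<^sub>0 'k::field" and p
  assume "insert_tensor [] r [] = insert_tensor [] r' []"
  then have "Poly_Mapping.lookup (insert_tensor [] r []) [fst p, snd p] =
      Poly_Mapping.lookup (insert_tensor [] r' []) [fst p, snd p]"
    by simp
  then show "Poly_Mapping.lookup r p = Poly_Mapping.lookup r' p"
    by (simp add: lookup_insert_tensor_Nil)
qed

text \<open>Insertion between two empty words is the linear identification of pairs with words of
  length 2, so the generating set is already a subspace and equals its span.\<close>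

lemma sandwich_0_0:
  assumes "free.subspace R"
  shows "sandwich I R 0 0 = (\<lambda>r. insert_tensor [] r []) ` R"
proof -
  let ?\<phi> = "\<lambda>r. insert_tensor [] r []"
  have zero: "?\<phi> 0 = 0"
    by (rule poly_mapping_eqI) (simp add: lookup_insert_tensor_Nil split: list.split)
  have add: "?\<phi> (x + y) = ?\<phi> x + ?\<phi> y" for x y
    by (rule poly_mapping_eqI)
      (simp add: lookup_insert_tensor_Nil lookup_add split: list.split)
  have scale: "?\<phi> (scale c x) = scale c (?\<phi> x)" for c x
    by (rule poly_mapping_eqI)
      (simp add: lookup_insert_tensor_Nil lookup_scale split: list.split)
  have "free.subspace (?\<phi> ` R)"
    unfolding free.subspace_def
  proof (intro conjI ballI allI)
    show "0 \<in> ?\<phi> ` R"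
      using zero free.subspace_0[OF assms] by (metis image_eqI)
  next
    fix x y
    assume "x \<in> ?\<phi> ` R" "y \<in> ?\<phi> ` R"
    then show "x + y \<in> ?\<phi> ` R"
      using free.subspace_add[OF assms] by (auto simp flip: add)
  next
    fix c x
    assume "x \<in> ?\<phi> ` R"
    then show "scale c x \<in> ?\<phi> ` R"
      using free.subspace_scale[OF assms] by (auto simp flip: scale)
  qed
  moreover have "{insert_tensor u r v | u r v. u \<in> lists I \<and> length u = 0 \<and> r \<in> R \<and>
      v \<in> lists I \<and> length v = 0} = ?\<phi> ` R"
    by auto
  ultimately show ?thesis
    by (simp add: sandwich_def free.span_eq_iff)
qed

text \<open>In degree 2 the only choice is \<open>i = j = 0\<close>, so the intersection of
  sandwiches has a single term.\<close>

lemma component_2_quadratic_coalgebra: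
  assumes "free.subspace R" and "R \<subseteq> free_on (I \<times> I)"
  shows "component (quadratic_coalgebra I R) 2 = (\<lambda>r. insert_tensor [] r []) ` R"
proof -
  have "insert_tensor [] r [] \<in> tensor_power I 2" if "r \<in> R" for r
    using that assms(2)
    by (auto simp: tensor_power_def in_free_on_iff lookup_insert_tensor_Nil subset_iff
        split: list.split)
  then show ?thesis
    by (auto simp: quadratic_coalgebra_def sandwich_0_0[OF assms(1)])
qed

lemma quadratic_coalgebra_eq_iff:
  assumes "free.subspace R" and "R \<subseteq> free_on (I \<times> I)"
    and "free.subspace R'" and "R' \<subseteq> free_on (I \<times> I)"
  shows "quadratic_coalgebra I R = quadratic_coalgebra I R' \<longleftrightarrow> R = R'"
  using component_2_quadratic_coalgebra[OF assms(1,2)]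
    component_2_quadratic_coalgebra[OF assms(3,4)] inj_image_eq_iff[OF inj_insert_tensor_Nil]
  by metis

text \<open>\<open>admissible\<close> quantifies existentially over a presentation of the coalgebra.
  The coalgebra determines its relation space, so the witness can only be \<open>R\<close> itself,
  and admissibility becomes a statement about \<open>proj S\<close> on \<open>R\<close>.\<close>

lemma admissible_quadratic_coalgebra_iff:
  assumes "free.subspace R" and "R \<subseteq> free_on (I \<times> I)"
  shows "admissible I S (quadratic_coalgebra I R) \<longleftrightarrow>
    S \<subseteq> I \<times> I \<and> bij_betw (proj S) R (free_on S)"
  unfolding admissible_def using quadratic_coalgebra_eq_iff[OF assms] assms by metis

section \<open>Coordinates with respect to the basis of relation vectors\<close>

lemma lookup_relation_vector:
  assumes "finite {s' \<in> compl_pairs I S. f s s' \<noteq> 0}"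
  shows "Poly_Mapping.lookup (relation_vector I S f s) w =
    (if w = s then 1 else 0) - (if w \<in> compl_pairs I S then f s w else 0)"
proof -
  have "(\<Sum>s'\<in>{s' \<in> compl_pairs I S. f s s' \<noteq> 0}.
      Poly_Mapping.lookup (Poly_Mapping.single s' (f s s')) w) =
      (if w \<in> compl_pairs I S then f s w else 0)"
    using assms by (simp add: lookup_single when_def)
  then show ?thesis
    by (auto simp: relation_vector_def lookup_minus lookup_sum lookup_single when_def)
qed

text \<open>Surjectivity of \<open>proj S\<close> onto the free space on \<open>S\<close> is encoded
  by \<open>relation_vector_in\<close>, since the relation vector of \<open>s\<close> projects to
  [s].\<close>

locale admissible_relations =
  fixes I :: "'i set" and S :: "('i \<times> 'i) set"
    and f :: "'i \<times> 'i \<Rightarrow> 'i \<times> 'i \<Rightarrow> 'k::field" and R :: "('i \<times> 'i \<Rightarrow>\<^sub>0 'k) set"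
  assumes S_subset: "S \<subseteq> I \<times> I"
    and subspace_R: "free.subspace R"
    and inj_on_proj: "inj_on (proj S) R"
    and finite_coeffs: "s \<in> S \<Longrightarrow> finite {s' \<in> compl_pairs I S. f s s' \<noteq> 0}"
    and relation_vector_in: "s \<in> S \<Longrightarrow> relation_vector I S f s \<in> R"
begin

lemma lookup_rv:
  "s \<in> S \<Longrightarrow> Poly_Mapping.lookup (relation_vector I S f s) w =
    (if w = s then 1 else 0) - (if w \<in> compl_pairs I S then f s w else 0)"
  by (rule lookup_relation_vector[OF finite_coeffs])

lemma eq_if_lookup_eq:
  assumes "x \<in> R" "y \<in> R" and "\<And>s. s \<in> S \<Longrightarrow> Poly_Mapping.lookup x s = Poly_Mapping.lookup y s"
  shows "x = y"
proof (rule inj_onD[OF inj_on_proj])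
  show "proj S x = proj S y"
    by (rule poly_mapping_eqI) (simp add: lookup_proj assms(3))
qed (rule assms)+

text \<open>The inverse of \<open>proj S\<close> on \<open>R\<close>, extended to all vectors by
  ignoring coordinates outside \<open>S\<close>. It lifts elements of the free space on
  \<open>S\<close> to \<open>R\<close> and expands elements of \<open>R\<close> in the
  basis.\<close>

definition section_vector :: "('i \<times> 'i \<Rightarrow>\<^sub>0 'k) \<Rightarrow> ('i \<times> 'i \<Rightarrow>\<^sub>0 'k)"
  where "section_vector x = (\<Sum>s\<in>Poly_Mapping.keys x \<inter> S.
    scale (Poly_Mapping.lookup x s) (relation_vector I S f s))"

lemma section_vector_in: "section_vector x \<in> R"
  unfolding section_vector_def
  by (intro free.subspace_sum free.subspace_scale subspace_R relation_vector_in) auto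

lemma lookup_section_vector:
  "Poly_Mapping.lookup (section_vector x) w =
    (if w \<in> S then Poly_Mapping.lookup x w
     else if w \<in> I \<times> I then - (\<Sum>s\<in>Poly_Mapping.keys x \<inter> S. Poly_Mapping.lookup x s * f s w)
     else 0)"
proof -
  have "Poly_Mapping.lookup (section_vector x) w =
      (\<Sum>s\<in>Poly_Mapping.keys x \<inter> S. Poly_Mapping.lookup x s *
        ((if w = s then 1 else 0) - (if w \<in> compl_pairs I S then f s w else 0)))"
    unfolding section_vector_def lookup_sum by (rule sum.cong) (auto simp: lookup_scale lookup_rv)
  also have "\<dots> = (\<Sum>s\<in>Poly_Mapping.keys x \<inter> S. (if w = s then Poly_Mapping.lookup x s else 0) -
      (if w \<in> compl_pairs I S then Poly_Mapping.lookup x s * f s w else 0))"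
    by (rule sum.cong) (auto simp: right_diff_distrib)
  also have "\<dots> = (\<Sum>s\<in>Poly_Mapping.keys x \<inter> S. if w = s then Poly_Mapping.lookup x s else 0) -
      (if w \<in> compl_pairs I S
       then \<Sum>s\<in>Poly_Mapping.keys x \<inter> S. Poly_Mapping.lookup x s * f s w else 0)"
    unfolding sum_subtractf by simp
  also have "(\<Sum>s\<in>Poly_Mapping.keys x \<inter> S. if w = s then Poly_Mapping.lookup x s else 0) =
      (if w \<in> S then Poly_Mapping.lookup x w else 0)"
    by (simp add: in_keys_iff)
  finally show ?thesis
    using S_subset by (auto simp: compl_pairs_def)
qed

lemma section_vector_eq: "x \<in> R \<Longrightarrow> section_vector x = x"
  by (rule eq_if_lookup_eq) (simp_all add: section_vector_in lookup_section_vector)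

section \<open>Admissibility of pullback and pushforward as vanishing of coefficients\<close>

lemma bij_betw_pullback_iff:
  "bij_betw (proj (S \<inter> (J \<times> J))) (pullback_rel J R) (free_on (S \<inter> (J \<times> J))) \<longleftrightarrow>
    (\<forall>s\<in>S \<inter> (J \<times> J). \<forall>s'\<in>compl_pairs I S - J \<times> J. f s s' = 0)"
proof
  assume bij: "bij_betw (proj (S \<inter> (J \<times> J))) (pullback_rel J R) (free_on (S \<inter> (J \<times> J)))"
  \<comment> \<open>Surjectivity suffices here: a preimage of [s] in the pullback must be the
    relation vector of \<open>s\<close>, whose coordinate at \<open>s'\<close> is minus
    \<open>f s s'\<close>.\<close>
  show "\<forall>s\<in>S \<inter> (J \<times> J). \<forall>s'\<in>compl_pairs I S - J \<times> J. f s s' = 0"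
  proof (intro ballI)
    fix s s'
    assume s: "s \<in> S \<inter> (J \<times> J)" and s': "s' \<in> compl_pairs I S - J \<times> J"
    have "Poly_Mapping.single s 1 \<in> free_on (S \<inter> (J \<times> J))"
      using s by (auto simp: in_free_on_iff lookup_single when_def)
    then have "Poly_Mapping.single s 1 \<in> proj (S \<inter> (J \<times> J)) ` pullback_rel J R"
      unfolding bij_betw_imp_surj_on[OF bij] .
    then obtain x where proj_x: "Poly_Mapping.single s 1 = proj (S \<inter> (J \<times> J)) x"
      and x: "x \<in> pullback_rel J R"
      by (rule imageE)
    have xR: "x \<in> R" and xJ: "\<And>w. w \<notin> J \<times> J \<Longrightarrow> Poly_Mapping.lookup x w = 0"
      using x unfolding pullback_rel_def Int_iff in_free_on_iff by blast+
    \<comment> \<open>Coordinates in \<open>S\<close> are compared. Inside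
      \<open>J \<times> J\<close> those of \<open>x\<close> are prescribed by its projection;
      outside, \<open>x\<close> vanishes because it lies in the pullback, and the relation vector
      vanishes because \<open>s\<close> is in \<open>J \<times> J\<close>.\<close>
    have "x = relation_vector I S f s"
    proof (rule eq_if_lookup_eq)
      fix t
      assume t: "t \<in> S"
      have "Poly_Mapping.lookup x t = Poly_Mapping.lookup (proj (S \<inter> (J \<times> J)) x) t"
        unfolding lookup_proj using xJ[of t] t by (cases "t \<in> J \<times> J") auto
      then show "Poly_Mapping.lookup x t = Poly_Mapping.lookup (relation_vector I S f s) t"
        using s t by (simp flip: proj_x add: lookup_rv lookup_single when_def compl_pairs_def)
    qed (use s xR relation_vector_in in auto)
    then show "f s s' = 0"
      using xJ[of s'] s s' by (auto simp: lookup_rv compl_pairs_def split: if_splits)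
  qed
next
  assume f0: "\<forall>s\<in>S \<inter> (J \<times> J). \<forall>s'\<in>compl_pairs I S - J \<times> J. f s s' = 0"
  show "bij_betw (proj (S \<inter> (J \<times> J))) (pullback_rel J R) (free_on (S \<inter> (J \<times> J)))"
  proof (rule bij_betw_imageI)
    \<comment> \<open>Elements of the pullback have no coordinates outside
      \<open>J \<times> J\<close>, so agreement on \<open>S \<inter> (J \<times> J)\<close> is
      agreement on all of \<open>S\<close>.\<close>
    show "inj_on (proj (S \<inter> (J \<times> J))) (pullback_rel J R)"
    proof (rule inj_onI)
      fix x y
      assume x: "x \<in> pullback_rel J R" and y: "y \<in> pullback_rel J R"
        and eq: "proj (S \<inter> (J \<times> J)) x = proj (S \<inter> (J \<times> J)) y"
      show "x = y"
      proof (rule eq_if_lookup_eq)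
        fix s
        assume "s \<in> S"
        then show "Poly_Mapping.lookup x s = Poly_Mapping.lookup y s"
          using x y arg_cong[OF eq, of "\<lambda>z. Poly_Mapping.lookup z s"]
          unfolding pullback_rel_def Int_iff in_free_on_iff lookup_proj
          by (cases "s \<in> J \<times> J") (simp_all del: mem_Times_iff split_paired_All)
      qed (use x y in \<open>auto simp: pullback_rel_def\<close>)
    qed
    have "t \<in> proj (S \<inter> (J \<times> J)) ` pullback_rel J R"
      if t: "t \<in> free_on (S \<inter> (J \<times> J))" for t :: "'i \<times> 'i \<Rightarrow>\<^sub>0 'k"
    proof (rule image_eqI)
      show "t = proj (S \<inter> (J \<times> J)) (section_vector t)"
        using t by (intro poly_mapping_eqI) (auto simp: lookup_proj lookup_section_vector in_free_on_iff)
      \<comment> \<open>The vanishing condition keeps the lift of \<open>t\<close> inside the free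
        space on \<open>J \<times> J\<close>: only relation vectors of pairs in
        \<open>S \<inter> (J \<times> J)\<close> occur in it.\<close>
      have "Poly_Mapping.lookup (section_vector t) w = 0" if w: "w \<notin> J \<times> J" for w
      proof -
        have "Poly_Mapping.lookup t s * f s w = 0" if "w \<in> I \<times> I - S" for s
        proof (cases "s \<in> S \<inter> (J \<times> J)")
          case True
          then have "f s w = 0"
            using f0 w that unfolding compl_pairs_def by blast
          then show ?thesis
            by simp
        next
          case False
          then have "Poly_Mapping.lookup t s = 0"
            using t unfolding in_free_on_iff by blast
          then show ?thesis
            by simp
        qed
        moreover have "Poly_Mapping.lookup t w = 0"
          using t w unfolding in_free_on_iff by blast
        ultimately show ?thesis
          unfolding lookup_section_vector by (simp add: sum.neutral)
      qed
      then show "section_vector t \<in> pullback_rel J R"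
        unfolding pullback_rel_def Int_iff in_free_on_iff using section_vector_in by blast
    qed
    then show "proj (S \<inter> (J \<times> J)) ` pullback_rel J R = free_on (S \<inter> (J \<times> J))"
      using proj_in_free_on by blast
  qed
qed

text \<open>In contrast to the pullback, surjectivity is automatic, because cutting a lift down to
  \<open>J \<times> J\<close> preserves its coordinates in \<open>S \<inter> (J \<times> J)\<close>.
  The condition on \<open>f\<close> governs injectivity.\<close>

lemma bij_betw_pushforward_iff:
  "bij_betw (proj (S \<inter> (J \<times> J))) (pushforward_rel J R) (free_on (S \<inter> (J \<times> J))) \<longleftrightarrow>
    (\<forall>s\<in>S - J \<times> J. \<forall>s'\<in>compl_pairs I S \<inter> (J \<times> J). f s s' = 0)"
proof
  assume bij: "bij_betw (proj (S \<inter> (J \<times> J))) (pushforward_rel J R) (free_on (S \<inter> (J \<times> J)))"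
  show "\<forall>s\<in>S - J \<times> J. \<forall>s'\<in>compl_pairs I S \<inter> (J \<times> J). f s s' = 0"
  proof (intro ballI)
    fix s s'
    assume s: "s \<in> S - J \<times> J" and s': "s' \<in> compl_pairs I S \<inter> (J \<times> J)"
    let ?x = "proj (J \<times> J) (relation_vector I S f s)"
    \<comment> \<open>The only coordinate of the relation vector in \<open>S\<close> is at
      \<open>s\<close>, outside \<open>J \<times> J\<close>, so \<open>?x\<close> has the same
      projection as 0.\<close>
    have "?x = 0"
    proof (rule inj_onD[OF bij_betw_imp_inj_on[OF bij]])
      show "?x \<in> pushforward_rel J R"
        using s relation_vector_in by (auto simp: pushforward_rel_def)
      show "0 \<in> pushforward_rel J R"
        by (rule free.subspace_0[OF subspace_pushforward_rel[OF subspace_R]])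
      show "proj (S \<inter> (J \<times> J)) ?x = proj (S \<inter> (J \<times> J)) 0"
        using s by (intro poly_mapping_eqI) (auto simp: lookup_proj lookup_rv compl_pairs_def)
    qed
    then have "Poly_Mapping.lookup ?x s' = 0"
      by simp
    then show "f s s' = 0"
      using s s' by (auto simp: lookup_proj lookup_rv split: if_splits)
  qed
next
  assume f0: "\<forall>s\<in>S - J \<times> J. \<forall>s'\<in>compl_pairs I S \<inter> (J \<times> J). f s s' = 0"
  show "bij_betw (proj (S \<inter> (J \<times> J))) (pushforward_rel J R) (free_on (S \<inter> (J \<times> J)))"
  proof (rule bij_betw_imageI)
    \<comment> \<open>Expand \<open>z\<close> as \<open>section_vector z\<close>. At a pair
      \<open>w\<close> of the complement inside \<open>J \<times> J\<close>, the term of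
      \<open>s\<close> vanishes in both cases: for \<open>s\<close> in \<open>J \<times> J\<close>
      its coordinate in \<open>z\<close> is 0, otherwise \<open>f s w\<close> is 0.\<close>
    have kernel: "proj (J \<times> J) z = 0"
      if z: "z \<in> R" and z0: "proj (S \<inter> (J \<times> J)) z = 0" for z
    proof (rule poly_mapping_eqI)
      fix w
      have zS: "Poly_Mapping.lookup z s = 0" if "s \<in> S \<inter> (J \<times> J)" for s
        using arg_cong[OF z0, of "\<lambda>z. Poly_Mapping.lookup z s"] that by (simp add: lookup_proj)
      have "Poly_Mapping.lookup (section_vector z) w = 0" if w: "w \<in> J \<times> J"
      proof -
        have "Poly_Mapping.lookup z s * f s w = 0" if "s \<in> S" "w \<in> I \<times> I - S" for s
          using f0 zS[of s] w that by (cases "s \<in> J \<times> J") (auto simp: compl_pairs_def)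
        then show ?thesis
          unfolding lookup_section_vector using zS[of w] w by (auto intro!: sum.neutral)
      qed
      then show "Poly_Mapping.lookup (proj (J \<times> J) z) w = Poly_Mapping.lookup 0 w"
        by (simp add: lookup_proj section_vector_eq[OF z])
    qed
    show "inj_on (proj (S \<inter> (J \<times> J))) (pushforward_rel J R)"
    proof (rule inj_onI)
      fix a b
      assume "a \<in> pushforward_rel J R" "b \<in> pushforward_rel J R"
        and eq: "proj (S \<inter> (J \<times> J)) a = proj (S \<inter> (J \<times> J)) b"
      then obtain x y where x: "x \<in> R" "a = proj (J \<times> J) x" and y: "y \<in> R" "b = proj (J \<times> J) y"
        by (auto simp: pushforward_rel_def)
      \<comment> \<open>Projecting first to \<open>J \<times> J\<close> does not affect coordinates
        in \<open>S \<inter> (J \<times> J)\<close>, so injectivity reduces to \<open>kernel\<close>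
        for the difference of lifts to \<open>R\<close>.\<close>
      have "proj (S \<inter> (J \<times> J)) (x - y) = proj (S \<inter> (J \<times> J)) a - proj (S \<inter> (J \<times> J)) b"
        by (rule poly_mapping_eqI) (auto simp: x y lookup_proj lookup_minus)
      then have "proj (J \<times> J) (x - y) = 0"
        using eq x y free.subspace_diff[OF subspace_R] by (intro kernel) auto
      then show "a = b"
        by (simp add: x y proj_diff)
    qed
    have "t \<in> proj (S \<inter> (J \<times> J)) ` pushforward_rel J R"
      if t: "t \<in> free_on (S \<inter> (J \<times> J))" for t :: "'i \<times> 'i \<Rightarrow>\<^sub>0 'k"
    proof (rule image_eqI)
      show "t = proj (S \<inter> (J \<times> J)) (proj (J \<times> J) (section_vector t))"
        using t by (intro poly_mapping_eqI) (auto simp: lookup_proj lookup_section_vector in_free_on_iff)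
      show "proj (J \<times> J) (section_vector t) \<in> pushforward_rel J R"
        using section_vector_in by (auto simp: pushforward_rel_def)
    qed
    then show "proj (S \<inter> (J \<times> J)) ` pushforward_rel J R = free_on (S \<inter> (J \<times> J))"
      using proj_in_free_on by blast
  qed
qed

end

section \<open>Exchange of the two vanishing conditions by self-duality\<close>

lemma self_dual_vanishing_iff:
  assumes S: "S \<subseteq> I \<times> I" and dual: "strictly_self_dual I S f \<sigma>" and J: "J \<subseteq> I"
  shows "(\<forall>s\<in>S \<inter> (J \<times> J). \<forall>s'\<in>compl_pairs I S - J \<times> J. f s s' = 0) \<longleftrightarrow>
    (\<forall>s\<in>S - \<sigma> ` J \<times> \<sigma> ` J. \<forall>s'\<in>compl_pairs I S \<inter> (\<sigma> ` J \<times> \<sigma> ` J). f s s' = 0)"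
proof -
  let ?m = "map_prod \<sigma> \<sigma>"
  have bij: "bij_betw \<sigma> I I" and bijS: "?m ` S = compl_pairs I S"
    and f: "\<And>s s'. s \<in> S \<Longrightarrow> s' \<in> compl_pairs I S \<Longrightarrow> f s s' = f (?m s') (?m s)"
    using dual by (auto simp: strictly_self_dual_def dual_coeff_def bij_betw_def)
  have inj: "inj_on ?m (I \<times> I)" and img: "?m ` (I \<times> I) = I \<times> I"
    using bij map_prod_inj_on[of \<sigma> I \<sigma> I] map_prod_surj_on[of \<sigma> I I \<sigma> I I]
    by (auto simp only: bij_betw_def)
  have imgJ: "?m ` (J \<times> J) = \<sigma> ` J \<times> \<sigma> ` J"
    by (rule map_prod_surj_on) auto
  have JI: "J \<times> J \<subseteq> I \<times> I"
    using J by blast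
  \<comment> \<open>Self-duality only sends \<open>S\<close> to its complement; the reverse
    direction follows by taking complements, as \<open>?m\<close> permutes
    \<open>I \<times> I\<close>.\<close>
  have bijS': "?m ` compl_pairs I S = S"
  proof -
    have "?m ` compl_pairs I S = ?m ` (I \<times> I) - ?m ` S"
      unfolding compl_pairs_def by (rule inj_on_image_set_diff[OF inj]) (use S in auto)
    also have "\<dots> = S"
      using S by (auto simp: img bijS compl_pairs_def)
    finally show ?thesis .
  qed
  have 1: "?m ` (S \<inter> (J \<times> J)) = compl_pairs I S \<inter> (\<sigma> ` J \<times> \<sigma> ` J)"
    using inj_on_image_Int[OF inj S JI] by (simp add: bijS imgJ)
  have 2: "?m ` (compl_pairs I S - J \<times> J) = S - \<sigma> ` J \<times> \<sigma> ` J"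
  proof -
    have "?m ` (compl_pairs I S - J \<times> J) = ?m ` compl_pairs I S - ?m ` (J \<times> J)"
      by (rule inj_on_image_set_diff[OF inj]) (use JI in \<open>auto simp: compl_pairs_def\<close>)
    then show ?thesis
      by (simp only: bijS' imgJ)
  qed
  have "(\<forall>s\<in>S \<inter> (J \<times> J). \<forall>s'\<in>compl_pairs I S - J \<times> J. f s s' = 0) \<longleftrightarrow>
      (\<forall>s\<in>S \<inter> (J \<times> J). \<forall>s'\<in>compl_pairs I S - J \<times> J. f (?m s') (?m s) = 0)"
    by (intro ball_cong refl) (simp add: f)
  \<comment> \<open>Self-duality has reversed the arguments of \<open>f\<close>, so the quantifiers
    change places: the image of \<open>s'\<close> is now the first argument.\<close>
  also have "\<dots> \<longleftrightarrow> (\<forall>t\<in>?m ` (compl_pairs I S - J \<times> J). \<forall>t'\<in>?m ` (S \<inter> (J \<times> J)). f t t' = 0)"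
    unfolding ball_simps by blast
  finally show ?thesis
    unfolding 1 2 .
qed

theorem proposition3p3p2:
  fixes I J :: "'i set"
    and S :: "('i \<times> 'i) set"
    and R :: "('i \<times> 'i \<Rightarrow>\<^sub>0 'k::field) set"
    and f :: "'i \<times> 'i \<Rightarrow> 'i \<times> 'i \<Rightarrow> 'k"
    and \<sigma> :: "'i \<Rightarrow> 'i"
  assumes "S \<subseteq> I \<times> I"
    and "free.subspace R" and "R \<subseteq> free_on (I \<times> I)"
    and "admissible I S (quadratic_coalgebra I R)"
    and "has_coefficients I S f R"
    and "dualizable I S f"
    and "strictly_self_dual I S f \<sigma>"
    and "J \<subseteq> I"
  shows "admissible J (restrict_pairs S J) (quadratic_coalgebra J (pullback_rel J R)) \<longleftrightarrow>
    admissible (\<sigma> ` J) (restrict_pairs S (\<sigma> ` J))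
      (quadratic_coalgebra (\<sigma> ` J) (pushforward_rel (\<sigma> ` J) R))"
proof -
  have S_R: "\<And>s. s \<in> S \<Longrightarrow> relation_vector I S f s \<in> R"
    using assms(5) free.span_base unfolding has_coefficients_def by blast
  interpret admissible_relations I S f R
    using assms S_R admissible_quadratic_coalgebra_iff[OF assms(2,3)]
    by unfold_locales (auto simp: has_coefficients_def bij_betw_def)
  \<comment> \<open>The pullback criterion is taken for \<open>J\<close>, the pushforward criterion
    for the image of \<open>J\<close> under \<open>\<sigma>\<close>.\<close>
  show ?thesis
    using bij_betw_pullback_iff bij_betw_pushforward_iff
      self_dual_vanishing_iff[OF assms(1,7,8)]
    unfolding restrict_pairs_def
      admissible_quadratic_coalgebra_iff[OF subspace_pullback_rel[OF assms(2)] pullback_rel_subset]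
      admissible_quadratic_coalgebra_iff[OF subspace_pushforward_rel[OF assms(2)]
        pushforward_rel_subset]
    by simp
qed

end
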